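(* For every set $\mathcal{D}\subset\mathcal{F}$ of cumulative distribution functions, $$(\chi_{rsc})_{\mathcal{A}_c}(\mathcal{D})=\chi_e(\mathcal{D}),$$ where $(\chi_{rsc})_{\mathcal{A}_c}(\mathcal{D})$ is the relative sequential compactness index of $\mathcal{D}$ in $\mathcal{F}$ equipped with the continuity approach structure $\mathcal{A}_c$, and $\chi_e(\mathcal{D})$ is the escape index of $\mathcal{D}$.
   Context: **Distribution functions.** A cumulative distribution function (cdf) is a non-decreasing right-continuous $F:\mathbb{R}\to\mathbb{R}$ with $\lim_{x\to-\infty}F(x)=0$, $\lim_{x\to\infty}F(x)=1$. $\mathcal{F}$ is the set of all cdf's, $\mathcal{F}_c$ the set of continuous ones. $D_u(F,G)=\sup_{x\in\mathbb{R}}|F(x)-G(x)|$, and $F\star G=\int_{-\infty}^\infty F(\cdot-y)\,dG(y)$ is convolution. **Continuity approach structure.** $\mathcal{A}_c$ is the initial approach structure on $\mathcal{F}$ for the source $(\mathcal{F}\to(\mathcal{F}_c,\mathcal{A}_{D_u}):F\mapsto F\star G)_{G\in\mathcal{F}_c}$, with $\mathcal{A}_{D_u}$ the approach structure of the metric $D_u$. Explicitly, it is given by the approach system $(\mathcal{A}_{c,F})_{F\in\mathcal{F}}$, where $\mathcal{A}_{c,F}$ is the set of all $\phi:\mathcal{F}\to[0,\infty]$ such that for all $\epsilon>0$ and $N<\infty$ there is a finite nonempty $\mathcal{K}\subset\mathcal{F}_c$ with $\min(\phi(H),N)\le\max_{G\in\mathcal{K}}D_u(F\star G,H\star G)+\epsilon$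 for all $H\in\mathcal{F}$. It is known that equivalently $\mathcal{A}_{c,F}$ is the set of all $\phi:\mathcal{F}\to[0,\infty]$ such that for all $\epsilon>0$, $N<\infty$ there is $\alpha>0$ with $\min(\phi(H),N)\le\phi_{F,\alpha}(H)+\epsilon$ for all $H\in\mathcal{F}$, where $\phi_{F,\alpha}(H)=\sup_{x\in\mathbb{R}}\max\{F(x-\alpha)-H(x),\,H(x)-F(x+\alpha)\}$. **Relative sequential compactness index.** For $\epsilon>0$, a sequence $(F_n)_n$ in $\mathcal{F}$ is $\epsilon$-convergent to $F\in\mathcal{F}$ if for every $\phi\in\mathcal{A}_{c,F}$ one has $\phi(F_n)<\epsilon$ for all sufficiently large $n$. $\mathcal{D}$ is $\epsilon$-relatively sequentially compact if every sequence in $\mathcal{D}$ has a subsequence which is $\epsilon$-convergent to some $F\in\mathcal{F}$. $(\chi_{rsc})_{\mathcal{A}_c}(\mathcal{D})=\inf\{\alpha>0\mid\mathcal{D}\text{ is }\alpha\text{-relatively sequentially compact}\}$. **Escape index.** $\chi_e(\mathcal{D})=\inf_{M>0}\sup_{F\in\mathcal{D}}\max\{F(-M),1-F(M)\}$ (suprema taken in $[0,1]$, so $\sup\emptyset=0$). *)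

theory Defs
  imports "HOL-Probability.Probability"
begin

definition cdfs :: "(real \<Rightarrow> real) set" where
  "cdfs = {F. mono F \<and> (\<forall>x. continuous (at_right x) F)
            \<and> (F \<longlongrightarrow> 0) at_bot \<and> (F \<longlongrightarrow> 1) at_top}"

definition continuous_cdfs :: "(real \<Rightarrow> real) set" where
  "continuous_cdfs = {F \<in> cdfs. continuous_on UNIV F}"

text \<open>
  All distances, suprema and infima below are taken in the complete lattice \<^typ>\<open>ennreal\<close>, that is
  \<open>[0,\<infinity>]\<close>, where the empty supremum is 0. The quantities embedded by \<^const>\<open>ennreal\<close> are
  nonnegative, so no truncation takes place.
\<close>

definition uniform_dist :: "(real \<Rightarrow> real) \<Rightarrow> (real \<Rightarrow> real) \<Rightarrow> ennreal" where
  "uniform_dist F G = (SUP x. ennreal \<bar>F x - G x\<bar>)"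

text \<open>\<^term>\<open>interval_measure G\<close> is the Lebesgue--Stieltjes measure of \<open>G\<close>.\<close>

definition cdf_convolution :: "(real \<Rightarrow> real) \<Rightarrow> (real \<Rightarrow> real) \<Rightarrow> real \<Rightarrow> real" where
  "cdf_convolution F G = (\<lambda>x. LINT y|interval_measure G. F (x - y))"

text \<open>
  The approach system at \<open>F\<close> of the initial approach structure on \<^const>\<open>cdfs\<close> for the maps
  \<open>F \<mapsto> cdf_convolution F G\<close> into (\<^const>\<open>continuous_cdfs\<close>, \<^const>\<open>uniform_dist\<close>), where \<open>G\<close> ranges
  over \<^const>\<open>continuous_cdfs\<close>. Its members are functions \<open>\<phi>\<close> from \<^const>\<open>cdfs\<close> to \<open>[0,\<infinity>]\<close>; the
  values of \<open>\<phi>\<close> outside \<^const>\<open>cdfs\<close> are arbitrary and never used.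
\<close>

definition continuity_approach_system :: "(real \<Rightarrow> real) \<Rightarrow> ((real \<Rightarrow> real) \<Rightarrow> ennreal) set" where
  "continuity_approach_system F =
    {\<phi>. \<forall>\<epsilon>::real. \<forall>N::ennreal. \<epsilon> > 0 \<longrightarrow> N < \<infinity> \<longrightarrow>
        (\<exists>K. finite K \<and> K \<noteq> {} \<and> K \<subseteq> continuous_cdfs \<and>
          (\<forall>H\<in>cdfs. min (\<phi> H) N
             \<le> Max ((\<lambda>G. uniform_dist (cdf_convolution F G) (cdf_convolution H G)) ` K)
               + ennreal \<epsilon>))}"

definition eps_convergent_to :: "real \<Rightarrow> (nat \<Rightarrow> real \<Rightarrow> real) \<Rightarrow> (real \<Rightarrow> real) \<Rightarrow> bool" where
  "eps_convergent_to \<epsilon> S F \<longleftrightarrow>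
    (\<forall>\<phi>\<in>continuity_approach_system F. \<forall>\<^sub>F n in sequentially. \<phi> (S n) < ennreal \<epsilon>)"

definition eps_rel_seq_compact :: "real \<Rightarrow> (real \<Rightarrow> real) set \<Rightarrow> bool" where
  "eps_rel_seq_compact \<epsilon> D \<longleftrightarrow>
    (\<forall>S::nat \<Rightarrow> real \<Rightarrow> real. range S \<subseteq> D \<longrightarrow>
      (\<exists>r::nat \<Rightarrow> nat. strict_mono r \<and> (\<exists>F\<in>cdfs. eps_convergent_to \<epsilon> (S \<circ> r) F)))"

definition chi_rsc :: "(real \<Rightarrow> real) set \<Rightarrow> ennreal" where
  "chi_rsc D = (INF \<alpha>\<in>{\<alpha>::real. \<alpha> > 0 \<and> eps_rel_seq_compact \<alpha> D}. ennreal \<alpha>)"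

definition chi_e :: "(real \<Rightarrow> real) set \<Rightarrow> ennreal" where
  "chi_e D = (INF M\<in>{0<..}. SUP F\<in>D. ennreal (max (F (- M)) (1 - F M)))"

end

theory Submission
  imports Defs
begin

text \<open>
  If the members of \<open>D\<close> carry mass at most \<open>c\<close> on each of the two tails outside \<open>[-M, M]\<close>, Helly's
  theorem extracts from a sequence in \<open>D\<close> a vaguely convergent subsequence. Its limit may be defective,
  but moving the missing mass to \<open>-M\<close> and \<open>M\<close> turns it into a cdf \<open>F\<close> such that, for all \<open>\<delta>, e > 0\<close>,
  eventually \<open>F (x - \<delta>) - c - e \<le> F\<^sub>n x \<le> F (x + \<delta>) + c + e\<close> for all \<open>x\<close>. After convolution with a
  continuous \<open>G\<close>, the shift by \<open>\<delta>\<close> is absorbed by the uniform continuity of \<open>G\<close>.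

  Conversely, if \<open>F\<^sub>n\<close> carries mass more than \<open>\<beta>\<close> on one of the tails outside \<open>[-n, n]\<close>, then smoothing
  with the uniform distribution on \<open>[0, 1]\<close> moves these tails by at most 1, while the tails of any
  candidate limit \<open>F\<close> vanish. Hence no subsequence is \<open>\<alpha>\<close>-convergent for \<open>\<alpha> < \<beta>\<close>.
\<close>

section \<open>Elementary facts on cdfs and their convolution\<close>

lemma cdfs_iff:
  "F \<in> cdfs \<longleftrightarrow> mono F \<and> (\<forall>x. continuous (at_right x) F) \<and> (F \<longlongrightarrow> 0) at_bot \<and> (F \<longlongrightarrow> 1) at_top"
  by (simp add: cdfs_def)

lemma cdfsD:
  assumes "F \<in> cdfs"
  shows "mono F" "continuous (at_right x) F" "(F \<longlongrightarrow> 0) at_bot" "(F \<longlongrightarrow> 1) at_top"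
  using assms by (auto simp: cdfs_iff)

lemma real_distribution_cdfs: "F \<in> cdfs \<Longrightarrow> real_distribution (interval_measure F)"
  by (intro real_distribution_interval_measure) (auto simp: cdfs_iff mono_def)

lemma cdf_interval_measure_cdfs: "F \<in> cdfs \<Longrightarrow> cdf (interval_measure F) = F"
  by (intro cdf_interval_measure) (auto simp: cdfs_iff mono_def)

lemma cdfs_nonneg: "F \<in> cdfs \<Longrightarrow> 0 \<le> F x"
  by (metis cdf_interval_measure_cdfs cdf_def measure_nonneg)

lemma cdfs_le_1: "F \<in> cdfs \<Longrightarrow> F x \<le> 1"
  by (metis cdf_interval_measure_cdfs real_distribution_cdfs real_distribution.cdf_bounded_prob)

lemma cdfs_borel_measurable: "F \<in> cdfs \<Longrightarrow> F \<in> borel_measurable borel"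
  by (intro borel_measurable_mono) (rule cdfsD)

lemma cdfs_integrable_shift:
  assumes "F \<in> cdfs" "G \<in> cdfs"
  shows "integrable (interval_measure G) (\<lambda>y. F (x - y))"
proof -
  interpret G: real_distribution "interval_measure G"
    using assms by (intro real_distribution_cdfs)
  have [measurable]: "F \<in> borel_measurable borel"
    using assms by (intro cdfs_borel_measurable)
  show ?thesis
    by (rule G.integrable_const_bound[where B = 1])
      (auto simp: cdfs_nonneg[OF assms(1)] cdfs_le_1[OF assms(1)])
qed

text \<open>Both sides are the probability of \<open>X + Y \<le> x\<close> for independent \<open>X\<close>, \<open>Y\<close>.\<close>

lemma cdf_convolution_commute:
  assumes "F \<in> cdfs" "G \<in> cdfs"
  shows "cdf_convolution F G x = cdf_convolution G F x"
proof -
  interpret F: real_distribution "interval_measure F"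
    using assms by (intro real_distribution_cdfs)
  interpret G: real_distribution "interval_measure G"
    using assms by (intro real_distribution_cdfs)
  interpret FG: pair_sigma_finite "interval_measure F" "interval_measure G" ..
  define A where "A = {p :: real \<times> real. fst p + snd p \<le> x}"
  have A: "A \<in> sets (interval_measure F \<Otimes>\<^sub>M interval_measure G)"
  proof -
    have "{p \<in> space (borel \<Otimes>\<^sub>M borel). fst p + snd p \<le> x} \<in> sets (borel \<Otimes>\<^sub>M borel)"
      by measurable
    then show ?thesis by (simp add: A_def space_pair_measure)
  qed
  have emeasure: "emeasure (interval_measure H) {..z} = ennreal (H z)" if "H \<in> cdfs" for H z
  proof -
    interpret H: real_distribution "interval_measure H"
      using that by (intro real_distribution_cdfs)
    show ?thesis
      using cdf_interval_measure_cdfs[OF that] by (metis H.emeasure_eq_measure cdf_def)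
  qed
  have conv: "(\<integral>\<^sup>+ y. ennreal (F' (x - y)) \<partial>interval_measure G') = ennreal (cdf_convolution F' G' x)"
    if "F' \<in> cdfs" "G' \<in> cdfs" for F' G'
    unfolding cdf_convolution_def
    by (intro nn_integral_eq_integral cdfs_integrable_shift that) (simp add: cdfs_nonneg that)
  have sec1: "Pair z -` A = {..x - z}" and sec2: "(\<lambda>z. (z, y)) -` A = {..x - y}" for y z
    by (auto simp: A_def algebra_simps)
  have "ennreal (cdf_convolution F G x) = emeasure (interval_measure F \<Otimes>\<^sub>M interval_measure G) A"
    by (simp add: FG.emeasure_pair_measure_alt2[OF A] sec2 emeasure assms conv)
  also have "\<dots> = ennreal (cdf_convolution G F x)"
    by (simp add: G.emeasure_pair_measure_alt[OF A] sec1 emeasure assms conv)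
  finally show ?thesis
    by (subst (asm) ennreal_inj)
      (auto simp: cdf_convolution_def cdfs_nonneg assms intro!: Bochner_Integration.integral_nonneg)
qed

text \<open>The pointwise bound is integrated against \<open>G\<close>, whose total mass 1 leaves
  the constant \<open>c\<close> unchanged. Separate points \<open>x\<close> and \<open>x'\<close>
  let it serve for translated arguments.\<close>

lemma cdf_convolution_le_add:
  assumes "F \<in> cdfs" "F' \<in> cdfs" "G \<in> cdfs" and le: "\<And>y. F (x - y) \<le> F' (x' - y) + c"
  shows "cdf_convolution F G x \<le> cdf_convolution F' G x' + c"
proof -
  interpret G: real_distribution "interval_measure G"
    using assms by (intro real_distribution_cdfs)
  note int = cdfs_integrable_shift[OF assms(2,3)] cdfs_integrable_shift[OF assms(1,3)]
  have "cdf_convolution F G x \<le> (LINT y|interval_measure G. F' (x' - y) + c)"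
    unfolding cdf_convolution_def by (intro integral_mono int le Bochner_Integration.integrable_add) auto
  also have "\<dots> = cdf_convolution F' G x' + c"
    unfolding cdf_convolution_def
    by (subst Bochner_Integration.integral_add) (auto simp: int G.prob_space[simplified])
  finally show ?thesis .
qed

section \<open>From shifted bounds to epsilon-convergence\<close>

text \<open>Far out on either side \<open>G\<close> stays within \<open>e\<close> of its limit; the
  remaining bounded range falls to uniform continuity on a compact interval.\<close>

lemma continuous_cdfs_uniform:
  fixes G :: "real \<Rightarrow> real"
  assumes "G \<in> continuous_cdfs" "e > 0"
  obtains d where "d > 0" "\<And>x. G (x + d) \<le> G x + e"
proof -
  have G: "G \<in> cdfs" "continuous_on UNIV G"
    using assms by (auto simp: continuous_cdfs_def)
  note mono = monoD[OF cdfsD(1)[OF G(1)]]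
  obtain a where a: "\<And>x. x \<le> a \<Longrightarrow> G x < e"
    using order_tendstoD(2)[OF cdfsD(3)[OF G(1)] \<open>e > 0\<close>] by (auto simp: eventually_at_bot_linorder)
  obtain b where b: "\<And>x. x \<ge> b \<Longrightarrow> G x > 1 - e"
    using order_tendstoD(1)[OF cdfsD(4)[OF G(1)], of "1 - e"] \<open>e > 0\<close>
    by (auto simp: eventually_at_top_linorder)
  have "uniformly_continuous_on {a - 1..b + 1} G"
    by (intro compact_uniformly_continuous continuous_on_subset[OF G(2)]) auto
  then obtain d0 where d0: "d0 > 0"
    "\<And>x y. \<lbrakk>x \<in> {a - 1..b + 1}; y \<in> {a - 1..b + 1}; dist y x < d0\<rbrakk> \<Longrightarrow> dist (G y) (G x) < e"
    unfolding uniformly_continuous_on_def using \<open>e > 0\<close> by metis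
  \<comment> \<open>The cap 1 matches the margins of \<open>{a - 1..b + 1}\<close>: when neither
    tail case applies, both \<open>x\<close> and \<open>x + d\<close> lie in that interval.\<close>
  define d where "d = min 1 (d0 / 2)"
  have d: "0 < d" "d \<le> 1" "d < d0"
    using d0(1) by (auto simp: d_def)
  have "G (x + d) \<le> G x + e" for x
  proof -
    consider "x + d \<le> a" | "x \<ge> b" | "x \<in> {a - 1..b + 1}" "x + d \<in> {a - 1..b + 1}"
      using d by fastforce
    then show ?thesis
    proof cases
      case 1
      then show ?thesis using a[OF 1] cdfs_nonneg[OF G(1), of x] by linarith
    next
      case 2
      then show ?thesis using b[OF 2] cdfs_le_1[OF G(1), of "x + d"] by linarith
    next
      case 3
      then show ?thesis using d0(2)[of x "x + d"] d by (simp add: dist_real_def)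
    qed
  qed
  then show thesis using d(1) that by blast
qed

text \<open>Since convolution is commutative, the translation of \<open>F\<close> by
  \<open>d\<close> can be traded for one of \<open>G\<close>, where it costs only
  \<open>e\<close>.\<close>

lemma uniform_dist_convolution_le:
  assumes F: "F \<in> cdfs" and H: "H \<in> cdfs" and G: "G \<in> cdfs"
    and d: "\<And>x. G (x + d) \<le> G x + e"
    and lower: "\<And>x. F (x - d) \<le> H x + c" and upper: "\<And>x. H x \<le> F (x + d) + c"
  shows "uniform_dist (cdf_convolution F G) (cdf_convolution H G) \<le> ennreal (c + e)"
  unfolding uniform_dist_def
proof (intro SUP_least ennreal_leI)
  fix x
  have shift: "cdf_convolution F G (x + d) \<le> cdf_convolution F G x + e" for x
    unfolding cdf_convolution_commute[OF F G]
    using d by (intro cdf_convolution_le_add F G) (metis diff_add_eq)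
  have "cdf_convolution H G x \<le> cdf_convolution F G (x + d) + c"
    using upper by (intro cdf_convolution_le_add F G H) (metis diff_add_eq)
  moreover have "cdf_convolution F G (x - d) \<le> cdf_convolution H G x + c"
    using lower by (intro cdf_convolution_le_add F G H) (metis diff_diff_eq add.commute)
  ultimately show "\<bar>cdf_convolution F G x - cdf_convolution H G x\<bar> \<le> c + e"
    using shift[of x] shift[of "x - d"] by (auto simp: abs_le_iff)
qed

text \<open>Each test function is controlled up to \<open>e\<close> by finitely many continuous
  \<open>G\<close>; choosing \<open>d\<close> for each \<open>G\<close> separately makes the shifted
  bounds cost only \<open>c\<close> plus small errors.\<close>

lemma eps_convergent_toI:
  assumes "F \<in> cdfs" and S: "\<And>n. S n \<in> cdfs" and "0 \<le> c" "c < \<alpha>"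
    and lower: "\<And>d e. d > 0 \<Longrightarrow> e > 0 \<Longrightarrow> \<forall>\<^sub>F n in sequentially. \<forall>x. F (x - d) \<le> S n x + c + e"
    and upper: "\<And>d e. d > 0 \<Longrightarrow> e > 0 \<Longrightarrow> \<forall>\<^sub>F n in sequentially. \<forall>x. S n x \<le> F (x + d) + c + e"
  shows "eps_convergent_to \<alpha> S F"
  unfolding eps_convergent_to_def
proof
  fix \<phi> assume \<phi>: "\<phi> \<in> continuity_approach_system F"
  \<comment> \<open>Three errors of size \<open>e\<close> arise, from the shifted bounds, from the
    modulus of \<open>G\<close> and from the approach system, and
    \<open>c + 3 * e < \<alpha>\<close>.\<close>
  define e where "e = (\<alpha> - c) / 4"
  have e: "e > 0" using \<open>c < \<alpha>\<close> by (simp add: e_def)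
  \<comment> \<open>Truncation at \<open>N = \<alpha>\<close> suffices: once the minimum is below
    \<open>\<alpha>\<close>, so is \<open>\<phi> H\<close>.\<close>
  have "\<exists>K. finite K \<and> K \<noteq> {} \<and> K \<subseteq> continuous_cdfs \<and> (\<forall>H\<in>cdfs. min (\<phi> H) (ennreal \<alpha>) \<le>
      Max ((\<lambda>G. uniform_dist (cdf_convolution F G) (cdf_convolution H G)) ` K) + ennreal e)"
    using \<phi> e unfolding continuity_approach_system_def by simp
  then obtain K where K: "finite K" "K \<noteq> {}" "K \<subseteq> continuous_cdfs"
    and bound: "\<forall>H\<in>cdfs. min (\<phi> H) (ennreal \<alpha>) \<le>
      Max ((\<lambda>G. uniform_dist (cdf_convolution F G) (cdf_convolution H G)) ` K) + ennreal e"
    by (elim exE conjE) (rule that)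
  have "\<forall>\<^sub>F n in sequentially.
    uniform_dist (cdf_convolution F G) (cdf_convolution (S n) G) \<le> ennreal (c + e + e)" if "G \<in> K" for G
  proof -
    have G: "G \<in> continuous_cdfs" using that K by blast
    obtain d where d: "d > 0" "\<And>x. G (x + d) \<le> G x + e"
      using continuous_cdfs_uniform[OF G e] by blast
    show ?thesis
      using lower[OF d(1) e] upper[OF d(1) e]
    proof eventually_elim
      case (elim n)
      show ?case
        using elim d G
        by (intro uniform_dist_convolution_le[where d = d] assms) (auto simp: continuous_cdfs_def add.assoc)
    qed
  qed
  then have "\<forall>\<^sub>F n in sequentially. \<forall>G\<in>K.
    uniform_dist (cdf_convolution F G) (cdf_convolution (S n) G) \<le> ennreal (c + e + e)"
    using K(1) by (simp add: eventually_ball_finite_distrib)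
  then show "\<forall>\<^sub>F n in sequentially. \<phi> (S n) < ennreal \<alpha>"
  proof eventually_elim
    case (elim n)
    have "min (\<phi> (S n)) (ennreal \<alpha>) \<le> ennreal (c + e + e) + ennreal e"
      using elim K(1,2) by (intro order_trans[OF bspec[OF bound S]] add_right_mono) auto
    also have "\<dots> = ennreal (c + e + e + e)"
      using e \<open>0 \<le> c\<close> by (intro ennreal_plus[symmetric]) auto
    also have "\<dots> < ennreal \<alpha>"
      using e \<open>0 \<le> c\<close> by (intro ennreal_lessI) (auto simp: e_def field_simps)
    finally show ?case by (auto simp: min_def split: if_splits)
  qed
qed

section \<open>Helly limits and relative compactness from escape bounds\<close>

text \<open>A monotone function has only countably many discontinuities, and a nonempty open
  interval is uncountable.\<close>

lemma isCont_between_mono: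
  fixes F :: "real \<Rightarrow> real"
  assumes "mono F" "a < b"
  obtains x where "a < x" "x < b" "isCont F x"
  using open_minus_countable[OF mono_ctble_discont[OF \<open>mono F\<close>], of "{a<..<b}"] assms by auto

text \<open>A Polya-type argument: convergence at finitely many continuity points controls all of
  \<open>K\<close> by monotonicity. The shift \<open>d\<close> stands in for continuity of
  \<open>F\<close>, as it steps over any jump inside a short covering interval.\<close>

lemma mono_convergent_shift_uniform:
  fixes f :: "nat \<Rightarrow> real \<Rightarrow> real" and F :: "real \<Rightarrow> real"
  assumes f: "\<And>n. mono (f n)" and F: "mono F"
    and lim: "\<And>x. isCont F x \<Longrightarrow> (\<lambda>n. f n x) \<longlonglongrightarrow> F x"
    and "compact K" "d > 0" "e > 0"
  shows "\<forall>\<^sub>F n in sequentially. \<forall>x\<in>K. F (x - d) - e \<le> f n x \<and> f n x \<le> F (x + d) + e"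
proof -
  have "\<exists>p q. p < y \<and> y < q \<and> q - p < d \<and> isCont F p \<and> isCont F q" for y
  proof -
    obtain p where "y - d / 2 < p" "p < y" "isCont F p"
      using isCont_between_mono[OF F, of "y - d / 2" y] \<open>d > 0\<close> by auto
    moreover obtain q where "y < q" "q < y + d / 2" "isCont F q"
      using isCont_between_mono[OF F, of y "y + d / 2"] \<open>d > 0\<close> by auto
    ultimately show ?thesis by (intro exI[of _ p] exI[of _ q]) (auto simp: field_simps)
  qed
  then obtain p q where pq: "\<And>y. p y < y" "\<And>y. y < q y" "\<And>y. q y - p y < d"
    "\<And>y. isCont F (p y)" "\<And>y. isCont F (q y)"
    by metis
  have "K \<subseteq> (\<Union>y\<in>K. {p y<..<q y})"
    using pq by auto
  then obtain C where C: "C \<subseteq> K" "finite C" "K \<subseteq> (\<Union>y\<in>C. {p y<..<q y})"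
    using compactE_image[OF \<open>compact K\<close>, of K "\<lambda>y. {p y<..<q y}"] by auto
  have "\<forall>\<^sub>F n in sequentially. F (p y) - e < f n (p y) \<and> f n (q y) < F (q y) + e" for y
    using \<open>e > 0\<close> by (intro eventually_conj order_tendstoD[OF lim] pq) auto
  then have "\<forall>\<^sub>F n in sequentially. \<forall>y\<in>C. F (p y) - e < f n (p y) \<and> f n (q y) < F (q y) + e"
    using C(2) by (simp add: eventually_ball_finite_distrib)
  then show ?thesis
  proof (eventually_elim, intro ballI)
    fix n x assume n: "\<forall>y\<in>C. F (p y) - e < f n (p y) \<and> f n (q y) < F (q y) + e" and "x \<in> K"
    then obtain y where y: "y \<in> C" "p y < x" "x < q y" using C(3) by auto
    \<comment> \<open>As \<open>q y - p y < d\<close>, the points are ordered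
      \<open>x - d < p y < x < q y < x + d\<close>.\<close>
    have "F (x - d) \<le> F (p y)" "f n (p y) \<le> f n x" "f n x \<le> f n (q y)" "F (q y) \<le> F (x + d)"
      using y pq(3)[of y] by (auto intro!: monoD[OF F] monoD[OF f])
    with n y(1) show "F (x - d) - e \<le> f n x \<and> f n x \<le> F (x + d) + e" by fastforce
  qed
qed

lemma clamp_in_cdfs:
  fixes F :: "real \<Rightarrow> real"
  assumes "mono F" "\<And>x. continuous (at_right x) F" "\<And>x. 0 \<le> F x" "\<And>x. F x \<le> 1" "a \<le> b"
  shows "(\<lambda>x. if x < a then 0 else if x < b then F x else 1) \<in> cdfs" (is "?H \<in> cdfs")
  unfolding cdfs_iff
proof (intro conjI allI)
  show "mono ?H"
    using assms by (auto simp: mono_def)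
  have "\<forall>\<^sub>F x in at_bot. ?H x = 0"
    by (rule eventually_mono[OF eventually_gt_at_bot[of a]]) auto
  then show "(?H \<longlongrightarrow> 0) at_bot" by (rule tendsto_eventually)
  have "\<forall>\<^sub>F x in at_top. ?H x = 1"
    by (rule eventually_mono[OF eventually_ge_at_top[of b]]) (use assms in auto)
  then show "(?H \<longlongrightarrow> 1) at_top" by (rule tendsto_eventually)
  fix x
  \<comment> \<open>Comparison by \<open><\<close> with a fixed number does not change on a short
    interval to the right of \<open>x\<close>, even when \<open>x\<close> is that number, so the
    branch of \<open>?H\<close> is fixed there.\<close>
  have "\<forall>\<^sub>F y in at_right x. (y < a \<longleftrightarrow> x < a) \<and> (y < b \<longleftrightarrow> x < b)"
  proof -
    have "\<forall>\<^sub>F y in at_right x. y < c \<longleftrightarrow> x < c" for c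
    proof (cases "x < c")
      case True
      then show ?thesis by (auto simp: eventually_at_right[OF True])
    next
      case False
      then show ?thesis by (auto simp: eventually_at_filter)
    qed
    then show ?thesis by (intro eventually_conj)
  qed
  then have "\<forall>\<^sub>F y in at_right x. (if x < a then 0 else if x < b then F y else 1) = ?H y"
    by eventually_elim auto
  moreover have "((\<lambda>y. if x < a then 0 else if x < b then F y else 1) \<longlongrightarrow> ?H x) (at_right x)"
    using assms(2)[of x] by (auto simp: continuous_within)
  ultimately show "continuous (at_right x) ?H"
    unfolding continuous_within by (rule Lim_transform_eventually[rotated])
qed

lemma eps_rel_seq_compactI:
  assumes D: "D \<subseteq> cdfs" and "M > 0" "0 \<le> c" "c < \<alpha>"
    and esc: "\<And>F. F \<in> D \<Longrightarrow> F (- M) \<le> c \<and> 1 - F M \<le> c"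
  shows "eps_rel_seq_compact \<alpha> D"
  unfolding eps_rel_seq_compact_def
proof (intro allI impI)
  fix S :: "nat \<Rightarrow> real \<Rightarrow> real" assume "range S \<subseteq> D"
  then have SD: "S n \<in> D" and S: "S n \<in> cdfs" for n using D by auto
  have "\<bar>S n x\<bar> \<le> 1" for n x
    using cdfs_nonneg[OF S] cdfs_le_1[OF S] by simp
  then obtain r F0 where r: "strict_mono (r :: nat \<Rightarrow> nat)"
    and F0: "\<And>x. continuous (at_right x) F0" "mono F0"
    and lim: "\<And>x. isCont F0 x \<Longrightarrow> (\<lambda>n. S (r n) x) \<longlonglongrightarrow> F0 x"
    using Helly_selection[of S 1, OF cdfsD(2)[OF S] cdfsD(1)[OF S]] by blast
  \<comment> \<open>Convergence is known only at continuity points, so the bounds are carried to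
    \<open>x\<close> from such points on either side.\<close>
  have nonneg: "0 \<le> F0 x" and le1: "F0 x \<le> 1" for x
  proof -
    obtain p where p: "p < x" "isCont F0 p"
      using isCont_between_mono[OF F0(2), of "x - 1" x] by auto
    obtain q where q: "x < q" "isCont F0 q"
      using isCont_between_mono[OF F0(2), of x "x + 1"] by auto
    have "0 \<le> F0 p" using lim[OF p(2)] by (rule LIMSEQ_le_const) (auto intro: cdfs_nonneg S)
    also have "\<dots> \<le> F0 x" using p by (intro monoD[OF F0(2)]) simp
    finally show "0 \<le> F0 x" .
    have "F0 x \<le> F0 q" using q by (intro monoD[OF F0(2)]) simp
    also have "\<dots> \<le> 1" using lim[OF q(2)] by (rule LIMSEQ_le_const2) (auto intro: cdfs_le_1 S)
    finally show "F0 x \<le> 1" .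
  qed
  define F where "F = (\<lambda>x. if x < - M then 0 else if x < M then F0 x else 1)"
  have F: "F \<in> cdfs"
    unfolding F_def using F0 nonneg le1 \<open>M > 0\<close> by (intro clamp_in_cdfs) auto
  have unif: "\<forall>\<^sub>F n in sequentially. \<forall>x. F (x - d) \<le> S (r n) x + c + e \<and> S (r n) x \<le> F (x + d) + c + e"
    if "d > 0" "e > 0" for d e
  proof -
    have "\<forall>\<^sub>F n in sequentially. \<forall>x\<in>{-M..M}. F0 (x - d) - e \<le> S (r n) x \<and> S (r n) x \<le> F0 (x + d) + e"
      by (intro mono_convergent_shift_uniform cdfsD(1)[OF S] F0 lim compact_Icc that)
    then show ?thesis
    proof (eventually_elim, intro allI)
      fix n x
      assume n: "\<forall>x\<in>{-M..M}. F0 (x - d) - e \<le> S (r n) x \<and> S (r n) x \<le> F0 (x + d) + e"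
      have F_le1: "F y \<le> 1" and F_nonneg: "0 \<le> F y" for y using F cdfs_le_1 cdfs_nonneg by auto
      note Sb = cdfs_nonneg[OF S, of "r n" x] cdfs_le_1[OF S, of "r n" x]
      \<comment> \<open>On the tails one inequality follows from \<open>F (x - d) = 0\<close> or
        \<open>F (x + d) = 1\<close>, the other from the escape bound \<open>c\<close>. In between,
        clamping can only lower \<open>F0\<close> left of \<open>M\<close> and only raise it from
        \<open>- M\<close> on, which is the favourable direction.\<close>
      consider "x < - M" | "x \<in> {-M..<M}" | "M \<le> x" by fastforce
      then show "F (x - d) \<le> S (r n) x + c + e \<and> S (r n) x \<le> F (x + d) + c + e"
      proof cases
        case 1
        have "S (r n) x \<le> S (r n) (- M)"
          using 1 by (intro monoD[OF cdfsD(1)[OF S]]) simp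
        moreover have "F (x - d) = 0" using 1 that by (simp add: F_def)
        ultimately show ?thesis
          using esc[OF SD, of "r n"] Sb F_nonneg[of "x + d"] that \<open>0 \<le> c\<close> by linarith
      next
        case 2
        have "F (x - d) \<le> F0 (x - d)" using 2 that nonneg by (simp add: F_def)
        moreover have "F0 (x + d) \<le> F (x + d)" using 2 that le1 by (simp add: F_def)
        moreover have "F0 (x - d) - e \<le> S (r n) x" "S (r n) x \<le> F0 (x + d) + e" using n 2 by auto
        ultimately show ?thesis using \<open>0 \<le> c\<close> by linarith
      next
        case 3
        have "S (r n) M \<le> S (r n) x"
          using 3 by (intro monoD[OF cdfsD(1)[OF S]]) simp
        moreover have "F (x + d) = 1" using 3 that \<open>M > 0\<close> by (simp add: F_def)
        ultimately show ?thesis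
          using esc[OF SD, of "r n"] Sb F_le1[of "x - d"] that \<open>0 \<le> c\<close> by linarith
      qed
    qed
  qed
  have "eps_convergent_to \<alpha> (S \<circ> r) F"
  proof (rule eps_convergent_toI[OF F _ \<open>0 \<le> c\<close> \<open>c < \<alpha>\<close>])
    show "(S \<circ> r) n \<in> cdfs" for n using S by simp
    fix d e :: real assume "d > 0" "e > 0"
    from unif[OF this]
    show "\<forall>\<^sub>F n in sequentially. \<forall>x. F (x - d) \<le> (S \<circ> r) n x + c + e"
      and "\<forall>\<^sub>F n in sequentially. \<forall>x. (S \<circ> r) n x \<le> F (x + d) + c + e"
      by (auto elim: eventually_mono)
  qed
  with r F show "\<exists>r. strict_mono r \<and> (\<exists>F\<in>cdfs. eps_convergent_to \<alpha> (S \<circ> r) F)" by blast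
qed

section \<open>Uniform smoothing and escape bounds from relative compactness\<close>

definition unit_uniform_cdf :: "real \<Rightarrow> real" where
  "unit_uniform_cdf x = max 0 (min 1 x)"

lemma unit_uniform_cdf_continuous_cdfs: "unit_uniform_cdf \<in> continuous_cdfs"
proof -
  have cont: "continuous_on UNIV unit_uniform_cdf"
    unfolding unit_uniform_cdf_def by (intro continuous_intros)
  have "\<forall>\<^sub>F x in at_bot. unit_uniform_cdf x = 0"
    by (rule eventually_mono[OF eventually_le_at_bot[of 0]]) (auto simp: unit_uniform_cdf_def)
  moreover have "\<forall>\<^sub>F x in at_top. unit_uniform_cdf x = 1"
    by (rule eventually_mono[OF eventually_ge_at_top[of 1]]) (auto simp: unit_uniform_cdf_def)
  ultimately show ?thesis
    using cont unfolding continuous_cdfs_def cdfs_iff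
    by (auto intro: tendsto_eventually continuous_at_imp_continuous_at_within
        simp: mono_def unit_uniform_cdf_def[abs_def] continuous_on_eq_continuous_at)
qed

text \<open>The uniform law lives on \<open>{0<..1}\<close>, so \<open>F (x - y)\<close> lies
  between \<open>F (x - 1)\<close> and \<open>F x\<close> almost surely, and averaging keeps these
  bounds.\<close>

lemma cdf_convolution_unit_uniform_bounds:
  assumes "F \<in> cdfs"
  shows "F (x - 1) \<le> cdf_convolution F unit_uniform_cdf x" "cdf_convolution F unit_uniform_cdf x \<le> F x"
proof -
  let ?U = "interval_measure unit_uniform_cdf"
  have U: "unit_uniform_cdf \<in> cdfs"
    using unit_uniform_cdf_continuous_cdfs by (simp add: continuous_cdfs_def)
  interpret U: real_distribution ?U
    using U by (rule real_distribution_cdfs)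
  have "emeasure ?U {0<..1} = ennreal (unit_uniform_cdf 1 - unit_uniform_cdf 0)"
    using cdfsD[OF U] by (intro emeasure_interval_measure_Ioc) (auto simp: mono_def)
  then have "U.prob {0<..1} = 1"
    by (simp add: U.emeasure_eq_measure unit_uniform_cdf_def)
  then have AE: "AE y in ?U. y \<in> {0<..1}"
    by (subst U.AE_in_set_eq_1) auto
  note int = cdfs_integrable_shift[OF assms U, of x]
  have "(LINT y|?U. F (x - 1)) \<le> cdf_convolution F unit_uniform_cdf x"
    unfolding cdf_convolution_def using AE
    by (intro integral_mono_AE int) (auto simp del: greaterThanAtMost_iff elim!: eventually_mono
      intro!: monoD[OF cdfsD(1)[OF assms]] dest: greaterThanAtMost_iff[THEN iffD1])
  then show "F (x - 1) \<le> cdf_convolution F unit_uniform_cdf x"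
    using U.prob_space by simp
  have "cdf_convolution F unit_uniform_cdf x \<le> (LINT y|?U. F x)"
    unfolding cdf_convolution_def using AE
    by (intro integral_mono_AE int) (auto simp del: greaterThanAtMost_iff elim!: eventually_mono
      intro!: monoD[OF cdfsD(1)[OF assms]] dest: greaterThanAtMost_iff[THEN iffD1])
  then show "cdf_convolution F unit_uniform_cdf x \<le> F x"
    using U.prob_space by simp
qed

text \<open>The singleton \<open>{G}\<close> serves as \<open>K\<close> for every
  \<open>\<epsilon>\<close> and \<open>N\<close>.\<close>

lemma uniform_dist_convolution_in_approach_system:
  assumes "G \<in> continuous_cdfs"
  shows "(\<lambda>H. uniform_dist (cdf_convolution F G) (cdf_convolution H G)) \<in> continuity_approach_system F"
  unfolding continuity_approach_system_def
  using assms by (auto intro!: exI[of _ "{G}"] min.coboundedI1)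

lemma uniform_dist_ge: "ennreal \<bar>F x - G x\<bar> \<le> uniform_dist F G"
  unfolding uniform_dist_def by (rule SUP_upper) simp

lemma escape_bound_of_eps_rel_seq_compact:
  assumes D: "D \<subseteq> cdfs" and "\<alpha> < \<beta>" and rsc: "eps_rel_seq_compact \<alpha> D"
  shows "\<exists>M>0. \<forall>F\<in>D. max (F (- M)) (1 - F M) \<le> \<beta>"
proof (rule ccontr)
  assume "\<not> ?thesis"
  \<comment> \<open>The radii \<open>Suc n\<close> are positive, and the extra 1 leaves room for the
    unit shift caused by smoothing.\<close>
  then have "\<forall>n. \<exists>F\<in>D. \<beta> < max (F (- real (Suc n))) (1 - F (real (Suc n)))"
    by (metis not_le of_nat_0_less_iff zero_less_Suc)
  then obtain S where SD: "\<And>n. S n \<in> D"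
    and esc: "\<And>n. \<beta> < max (S n (- real (Suc n))) (1 - S n (real (Suc n)))"
    by metis
  from rsc SD obtain r F where r: "strict_mono (r :: nat \<Rightarrow> nat)" and F: "F \<in> cdfs"
    and conv: "eps_convergent_to \<alpha> (S \<circ> r) F"
    unfolding eps_rel_seq_compact_def by blast
  let ?U = unit_uniform_cdf
  let ?N = "\<lambda>n. real (Suc (r n))"
  \<comment> \<open>A tail of \<open>F\<close> below \<open>e\<close> plus a distance below
    \<open>\<alpha>\<close> stays below \<open>\<beta>\<close>.\<close>
  define e where "e = \<beta> - \<alpha>"
  have "\<forall>\<^sub>F n in sequentially. uniform_dist (cdf_convolution F ?U) (cdf_convolution (S (r n)) ?U) < ennreal \<alpha>"
    using conv uniform_dist_convolution_in_approach_system[OF unit_uniform_cdf_continuous_cdfs]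
    unfolding eps_convergent_to_def by fastforce
  moreover have lim: "filterlim (\<lambda>n. real (r n)) at_top sequentially"
    by (intro filterlim_compose[OF filterlim_real_sequentially] filterlim_subseq r)
  have "\<forall>\<^sub>F n in sequentially. F (- real (r n)) < e"
    using \<open>\<alpha> < \<beta>\<close> lim
    by (intro order_tendstoD(2)[OF filterlim_compose[OF cdfsD(3)[OF F]]])
       (auto simp: e_def filterlim_uminus_at_top)
  moreover have "\<forall>\<^sub>F n in sequentially. 1 - e < F (real (r n))"
    using \<open>\<alpha> < \<beta>\<close> by (intro order_tendstoD(1)[OF filterlim_compose[OF cdfsD(4)[OF F] lim]]) (auto simp: e_def)
  ultimately have "\<forall>\<^sub>F n in sequentially. False"
  proof eventually_elim
    case (elim n)
    have S: "S (r n) \<in> cdfs" using SD D by blast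
    have less: "\<bar>cdf_convolution F ?U x - cdf_convolution (S (r n)) ?U x\<bar> < \<alpha>" for x
      using le_less_trans[OF uniform_dist_ge elim(1), of x] by (simp add: ennreal_less_iff)
    note b = cdf_convolution_unit_uniform_bounds
    show False
    proof (cases "\<beta> < S (r n) (- ?N n)")
      case True
      \<comment> \<open>At \<open>- real (r n)\<close> the smoothed \<open>S (r n)\<close> exceeds
        \<open>\<beta>\<close>, while the smoothed \<open>F\<close> is below \<open>e\<close>, so
        they differ by more than \<open>\<alpha>\<close>.\<close>
      have "S (r n) (- ?N n) \<le> cdf_convolution (S (r n)) ?U (- real (r n))"
        using b(1)[OF S, of "- real (r n)"] by (simp add: minus_diff_commute)
      then show False
        using True less[of "- real (r n)"] b(2)[OF F, of "- real (r n)"] elim(2)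
        by (simp add: e_def abs_less_iff)
    next
      case False
      then have "\<beta> < 1 - S (r n) (?N n)" using esc[of "r n"] by (simp add: max_def split: if_splits)
      \<comment> \<open>On the right the roles swap: at \<open>?N n\<close> the smoothed
        \<open>F\<close> is still above \<open>1 - e\<close>, while smoothing cannot lift
        \<open>S (r n)\<close> above its value, which is below \<open>1 - \<beta>\<close>.\<close>
      moreover have "F (real (r n)) \<le> cdf_convolution F ?U (?N n)"
        using b(1)[OF F, of "?N n"] by simp
      ultimately show False
        using less[of "?N n"] b(2)[OF S, of "?N n"] elim(3) by (simp add: e_def abs_less_iff)
    qed
  qed
  then show False by simp
qed

theorem theorem3p13:
  fixes D :: "(real \<Rightarrow> real) set"
  assumes "D \<subseteq> cdfs"
  shows "chi_rsc D = chi_e D"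
proof (rule antisym)
  show "chi_rsc D \<le> chi_e D"
    unfolding chi_e_def
  proof (rule INF_greatest)
    fix M :: real assume M: "M \<in> {0<..}"
    define s where "s = (SUP F\<in>D. ennreal (max (F (- M)) (1 - F M)))"
    \<comment> \<open>This excludes \<open>s = \<infinity>\<close>, so that \<open>s\<close> is a
      real threshold; for empty \<open>D\<close> it is 0.\<close>
    have "s \<le> 1"
      unfolding s_def
      using assms cdfs_nonneg cdfs_le_1 by (intro SUP_least) auto
    then obtain c where c: "s = ennreal c" "0 \<le> c"
      by (cases s) (auto simp: top_unique)
    have esc: "F (- M) \<le> c \<and> 1 - F M \<le> c" if "F \<in> D" for F
    proof -
      have "ennreal (max (F (- M)) (1 - F M)) \<le> ennreal c"
        unfolding c(1)[symmetric] s_def using that by (intro SUP_upper)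
      then show ?thesis using c(2) by (subst (asm) ennreal_le_iff) auto
    qed
    have "chi_rsc D \<le> ennreal c"
    proof (rule ennreal_le_epsilon)
      \<comment> \<open>The slack \<open>e\<close> gives the strict inequality
        \<open>c < c + e\<close>, and a positive index even when \<open>c = 0\<close>.\<close>
      fix e :: real assume "e > 0"
      then have "eps_rel_seq_compact (c + e) D"
        using M c(2) esc by (intro eps_rel_seq_compactI[OF assms, of M c]) auto
      then have "chi_rsc D \<le> ennreal (c + e)"
        unfolding chi_rsc_def using \<open>e > 0\<close> c(2) by (intro INF_lower) auto
      then show "chi_rsc D \<le> ennreal c + ennreal e"
        using \<open>e > 0\<close> c(2) by simp
    qed
    then show "chi_rsc D \<le> (SUP F\<in>D. ennreal (max (F (- M)) (1 - F M)))"
      using c(1) s_def by simp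
  qed
  show "chi_e D \<le> chi_rsc D"
    unfolding chi_rsc_def
  proof (rule INF_greatest, rule ennreal_le_epsilon)
    \<comment> \<open>The slack \<open>e\<close> is there because the escape bound is derived only
      for levels strictly above \<open>\<alpha>\<close>.\<close>
    fix \<alpha> e :: real assume \<alpha>: "\<alpha> \<in> {\<alpha>. 0 < \<alpha> \<and> eps_rel_seq_compact \<alpha> D}" and "e > 0"
    then obtain M where M: "M > 0" "\<forall>F\<in>D. max (F (- M)) (1 - F M) \<le> \<alpha> + e"
      using escape_bound_of_eps_rel_seq_compact[OF assms, of \<alpha> "\<alpha> + e"] by auto
    have "chi_e D \<le> (SUP F\<in>D. ennreal (max (F (- M)) (1 - F M)))"
      unfolding chi_e_def using M(1) by (intro INF_lower) auto
    also have "\<dots> \<le> ennreal (\<alpha> + e)"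
      using M(2) by (intro SUP_least ennreal_leI) auto
    finally show "chi_e D \<le> ennreal \<alpha> + ennreal e"
      using \<alpha> \<open>e > 0\<close> by simp
  qed
qed

end
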